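(* Let $\alpha\in\mathbb{R}$ be such that $\frac{\alpha}{\pi}$ is a quadratic irrational, and let $\mathcal{A}=\{A_0,A_1\}$, where $$A_0=\begin{pmatrix}1&0&0\\0&1&0\\0&0&0\end{pmatrix},\qquad A_1=\begin{pmatrix}1&\sin\alpha&\cos\alpha-1\\0&\cos\alpha&-\sin\alpha\\0&\sin\alpha&\cos\alpha\end{pmatrix}.$$ Then there is a constant $C_\alpha$ such that $$M_N\le C_\alpha N^{1/3},\qquad N\in\mathbb{N},$$ and this rate of growth is attained by an infinite product of matrices from $\mathcal{A}$, in the sense that there is a sequence $A(0),A(1),A(2),\dots$ of elements of $\mathcal{A}$ and a vector $x(0)\in\mathbb{R}^3$ such that the trajectory $x(k+1)=A(k)x(k)$, $k\ge 0$, satisfies $$\limsup_{N\to\infty}\frac{\log\|x(N)\|}{\log N}=\frac13 .$$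
   Context: Here $\|\cdot\|$ is the Euclidean norm on $\mathbb{R}^3$ and the corresponding operator norm on $3\times3$ matrices, and $M_N=M_N(\mathcal{A})=\max\{\|A(N)\cdots A(1)\| : A(j)\in\mathcal{A},\ j=1,\dots,N\}$. A quadratic irrational is an irrational real number that is a root of a quadratic polynomial with integer coefficients. *)

theory Defs
  imports "HOL-Analysis.Analysis"
begin

definition quadratic_irrational :: "real \<Rightarrow> bool" where
  "quadratic_irrational x \<longleftrightarrow>
     x \<notin> \<rat> \<and>
     (\<exists>a b c :: int. a \<noteq> 0 \<and> of_int a * x\<^sup>2 + of_int b * x + of_int c = 0)"

definition A0 :: "real^3^3" where
  "A0 = vector [vector [1, 0, 0],
                vector [0, 1, 0],
                vector [0, 0, 0]]"

definition A1 :: "real \<Rightarrow> real^3^3" where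
  "A1 \<alpha> = vector [vector [1, sin \<alpha>, cos \<alpha> - 1],
                  vector [0, cos \<alpha>, - sin \<alpha>],
                  vector [0, sin \<alpha>, cos \<alpha>]]"

definition matrix_family :: "real \<Rightarrow> (real^3^3) set" where
  "matrix_family \<alpha> = {A0, A1 \<alpha>}"

text \<open>The product \<open>A N ** \<dots> ** A 1\<close>; the value \<open>A 0\<close> is not used.\<close>

primrec matrix_prod :: "(nat \<Rightarrow> real^'n^'n) \<Rightarrow> nat \<Rightarrow> real^'n^'n" where
  "matrix_prod A 0 = mat 1"
| "matrix_prod A (Suc N) = A (Suc N) ** matrix_prod A N"

text \<open>Intended for finite nonempty \<open>S\<close>: then only finitely many products of length \<open>N\<close>
  occur and the maximum is a genuine one. The norm on \<open>real^'n\<close> is the Euclidean norm, so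
  \<open>onorm\<close> gives the corresponding operator norm of a matrix.\<close>

definition max_growth :: "(real^'n^'n) set \<Rightarrow> nat \<Rightarrow> real" where
  "max_growth S N =
     Max {onorm ((*v) (matrix_prod A N)) | A. \<forall>j\<in>{1..N}. A j \<in> S}"

primrec trajectory :: "(nat \<Rightarrow> real^'n^'n) \<Rightarrow> real^'n \<Rightarrow> nat \<Rightarrow> real^'n" where
  "trajectory A x0 0 = x0"
| "trajectory A x0 (Suc k) = A k *v trajectory A x0 k"

text \<open>The limit superior is taken in the extended reals, so that its existence is not an issue.
  Since \<open>ln 0 = 0\<close>, a trajectory that reaches \<open>0\<close>, and hence stays there, has growth exponent
  \<open>0\<close> here instead of \<open>-\<infinity>\<close>; this does not matter for the assertion that the exponent
  equals a given positive number.\<close>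

definition growth_exponent :: "(nat \<Rightarrow> real^'n) \<Rightarrow> ereal" where
  "growth_exponent x = limsup (\<lambda>N. ereal (ln (norm (x N)) / ln (real N)))"

end

theory Submission
  imports Defs "HOL-Analysis.Kronecker_Approximation_Theorem" "HOL-Real_Asymp.Real_Asymp"
begin

text \<open>The matrix \<open>A\<^sub>1\<close> fixes \<open>u = x\<^sub>1 - x\<^sub>3\<close> and rotates \<open>(x\<^sub>2, x\<^sub>3)\<close> by \<open>\<alpha>\<close>, while \<open>A\<^sub>0\<close> adds \<open>x\<^sub>3\<close> to
  \<open>u\<close> and projects \<open>(x\<^sub>2, x\<^sub>3)\<close> to the first axis. A projection after \<open>n\<close> rotations therefore
  multiplies the radius \<open>\<rho>\<close> by \<open>\<bar>cos (n \<alpha>)\<bar>\<close> and changes \<open>u\<close> by \<open>\<rho> \<bar>sin (n \<alpha>)\<bar>\<close> up to sign.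
  As \<open>\<alpha> / \<pi>\<close> is badly approximable, \<open>\<bar>sin (n \<alpha>)\<bar> \<ge> c / n\<close>; hence a small loss of radius costs many
  rotations, and with \<open>L\<^sup>3 = N\<close> the quantity \<open>\<bar>u\<bar> + 2 L \<rho>\<close> grows by at most \<open>n / (c L\<^sup>2)\<close> in
  each such step, which sums to a multiple of \<open>L\<close>.

  Conversely, there are infinitely many \<open>n\<close> for which \<open>n \<alpha>\<close> is within a multiple of \<open>1 / n\<close> of
  \<open>2 \<pi> \<int>\<close>. For such an \<open>n\<close>, repeating \<open>n\<close> rotations and a projection \<open>n\<^sup>2\<close> times keeps a fixed
  proportion of the radius and changes \<open>u\<close> by a multiple of \<open>n\<close> in time \<open>n\<^sup>2 (n + 1)\<close>. Stages of
  this kind with rapidly growing \<open>n\<close> are concatenated.\<close>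

section \<open>Diophantine properties of \<open>\<alpha> / pi\<close>\<close>

text \<open>Liouville's argument in degree two: \<open>q^2\<close> times the polynomial at
  \<open>p / q\<close> is a nonzero integer, so at least 1 in absolute value. As \<beta> is a root,
  this integer is also at most a multiple of \<open>q\<close> times \<open>|q \<beta> - p|\<close>
  when that distance is below 1.\<close>

lemma quadratic_irrational_badly_approximable:
  assumes "quadratic_irrational \<beta>"
  obtains c where "c > 0" "\<And>p q :: int. q > 0 \<Longrightarrow> c / of_int q \<le> \<bar>of_int q * \<beta> - of_int p\<bar>"
proof -
  obtain a b d :: int where irr: "\<beta> \<notin> \<rat>" and a: "a \<noteq> 0"
    and eq: "of_int a * \<beta>\<^sup>2 + of_int b * \<beta> + of_int d = 0"
    using assms unfolding quadratic_irrational_def by blast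
  \<comment> \<open>Eliminating \<open>p\<close> from the linear factor gives
    \<open>l = a (2 q \<beta> - y) + b q\<close>, so \<open>K q\<close> bounds \<open>|l|\<close> if
    \<open>|y| < 1\<close>. The summand 1 ensures \<open>K \<ge> 1\<close>, which settles the case
    \<open>|y| \<ge> 1\<close>.\<close>
  define K where "K = \<bar>real_of_int a\<bar> * (2 * \<bar>\<beta>\<bar> + 1) + \<bar>real_of_int b\<bar> + 1"
  have K: "K \<ge> 1" unfolding K_def by simp
  show thesis
  proof (rule that[of "1 / K"])
    show "1 / K > 0" using K by simp
    fix p q :: int
    assume q: "q > 0"
    define y where "y = of_int q * \<beta> - of_int p"
    show "1 / K / of_int q \<le> \<bar>of_int q * \<beta> - of_int p\<bar>"
    proof (cases "\<bar>y\<bar> \<ge> 1")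
      case True
      have "1 / K / of_int q \<le> 1" using K q
        by (simp add: divide_simps) (metis mult_mono' mult_1 of_int_1_le_iff int_one_le_iff_zero_less zero_le_one)
      then show ?thesis using True y_def by simp
    next
      case False
      define m where "m = a * p\<^sup>2 + b * p * q + d * q\<^sup>2"
      \<comment> \<open>\<open>m\<close> is \<open>q\<^sup>2\<close> times the value of the polynomial at \<open>p / q\<close>; the other factor is linear.\<close>
      define l where "l = of_int a * (of_int p + of_int q * \<beta>) + of_int b * of_int q"
      have meq: "of_int m = - y * l"
      proof -
        have "of_int m = of_int m - (of_int q)\<^sup>2 * (of_int a * \<beta>\<^sup>2 + of_int b * \<beta> + of_int d)"
          using eq by simp
        also have "\<dots> = - y * l"
          unfolding m_def y_def l_def by (simp add: algebra_simps power2_eq_square)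
        finally show ?thesis .
      qed
      have "m \<noteq> 0"
      proof
        assume "m = 0"
        then have "y = 0 \<or> l = 0" using meq by simp
        then show False
        proof
          assume "y = 0"
          then have "\<beta> = of_int p / of_int q" using q by (simp add: y_def field_simps)
          then show False using irr by simp
        next
          assume "l = 0"
          then have "\<beta> = of_int (- b * q - a * p) / of_int (a * q)" using q a
            by (simp add: l_def field_simps)
          then show False using irr by (metis Rats_divide Rats_of_int)
        qed
      qed
      then have "1 \<le> \<bar>real_of_int m\<bar>" by linarith
      also have "\<dots> = \<bar>y\<bar> * \<bar>l\<bar>" using meq by (simp add: abs_mult)
      also have "\<bar>l\<bar> \<le> K * of_int q"
      proof -
        have "l = of_int a * (2 * (of_int q * \<beta>) - y) + of_int b * of_int q"
          by (simp add: l_def y_def algebra_simps)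
        also have "\<bar>\<dots>\<bar> \<le> \<bar>of_int a\<bar> * (2 * (of_int q * \<bar>\<beta>\<bar>) + 1) + \<bar>of_int b\<bar> * of_int q"
        proof -
          have "\<bar>2 * (of_int q * \<beta>) - y\<bar> \<le> \<bar>2 * (of_int q * \<beta>)\<bar> + \<bar>y\<bar>" by linarith
          also have "\<dots> \<le> 2 * (of_int q * \<bar>\<beta>\<bar>) + 1"
            using False q by (simp add: abs_mult)
          finally show ?thesis using q
            by (intro order_trans[OF abs_triangle_ineq] add_mono) (simp_all add: abs_mult mult_left_mono)
        qed
        also have "\<dots> \<le> \<bar>of_int a\<bar> * (2 * (of_int q * \<bar>\<beta>\<bar>) + of_int q) + \<bar>of_int b\<bar> * of_int q"
          using q by (intro add_mono mult_left_mono) auto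
        also have "\<dots> \<le> K * of_int q" using q by (simp add: K_def algebra_simps)
        finally show ?thesis .
      qed
      finally have "1 \<le> \<bar>y\<bar> * (K * of_int q)" by (simp add: mult_left_mono)
      then show ?thesis using K q unfolding y_def by (simp add: field_simps)
    qed
  qed
qed

text \<open>The Taylor remainder \<open>|x|^3 / 6\<close> is at most \<open>|x| / 2\<close>, because
  \<open>x^2 \<le> 3\<close> on this interval.\<close>

lemma abs_sin_ge_half_abs:
  fixes x :: real
  assumes "\<bar>x\<bar> \<le> pi / 2"
  shows "\<bar>x\<bar> / 2 \<le> \<bar>sin x\<bar>"
proof -
  have "\<bar>sin x - x\<bar> \<le> inverse (fact 3) * \<bar>x\<bar> ^ 3"
    using Maclaurin_sin_bound[of x 3] by (simp add: sin_coeff_def eval_nat_numeral)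
  also have "\<dots> = \<bar>x\<bar> * (x\<^sup>2 / 6)" by (simp add: fact_numeral power2_eq_square power3_eq_cube flip: abs_mult)
  also have "\<dots> \<le> \<bar>x\<bar> * (1 / 2)"
  proof (rule mult_left_mono)
    have "\<bar>x\<bar> \<le> 16 / 10" using assms pi_less_4 pi_approx by (simp add: abs_real_def)
    then have "x\<^sup>2 \<le> (16 / 10)\<^sup>2" by (metis abs_le_square_iff abs_of_nonneg divide_nonneg_nonneg zero_le_numeral)
    then show "x\<^sup>2 / 6 \<le> 1 / 2" by (simp add: power2_eq_square)
  qed simp
  finally show ?thesis by linarith
qed

lemma cos_ge_one_minus_half_square: "1 - x\<^sup>2 / 2 \<le> cos x" for x :: real
proof -
  have "(sin (x / 2))\<^sup>2 \<le> (x / 2)\<^sup>2"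
    using abs_sin_x_le_abs_x[of "x / 2"] by (simp only: abs_le_square_iff)
  then show ?thesis using cos_double_sin[of "x / 2"] by (simp add: power2_eq_square)
qed

text \<open>With \<open>p\<close> the integer nearest to \<open>n \<alpha> / pi\<close>, the angle
  \<open>n \<alpha>\<close> is within \<open>pi / 2\<close> of \<open>pi p\<close>, where the sine
  is comparable to the distance.\<close>

lemma abs_sin_mult_ge:
  assumes "quadratic_irrational (\<alpha> / pi)"
  obtains c where "c > 0" "\<And>n :: nat. n \<ge> 1 \<Longrightarrow> c / real n \<le> \<bar>sin (real n * \<alpha>)\<bar>"
proof -
  obtain c where c: "c > 0"
    "\<And>p q :: int. q > 0 \<Longrightarrow> c / of_int q \<le> \<bar>of_int q * (\<alpha> / pi) - of_int p\<bar>"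
    using quadratic_irrational_badly_approximable[OF assms] by metis
  show thesis
  proof (rule that[of c])
    fix n :: nat assume n: "n \<ge> 1"
    define p where "p = round (real n * (\<alpha> / pi))"
    define y where "y = real n * (\<alpha> / pi) - of_int p"
    have y1: "\<bar>y\<bar> \<le> 1 / 2" unfolding y_def p_def
      using of_int_round_abs_le by (metis abs_minus_commute)
    have y2: "c / real n \<le> \<bar>y\<bar>" using c(2)[of "int n" p] n by (simp add: y_def)
    have "real n * \<alpha> = pi * y + pi * of_int p" by (simp add: y_def field_simps)
    moreover have "\<bar>sin (pi * y + pi * of_int p)\<bar> = \<bar>sin (pi * y)\<bar>"
    proof -
      have "\<bar>cos (pi * real_of_int p)\<bar> = 1" "sin (pi * real_of_int p) = 0"
        by (auto simp: sin_zero_iff_int2 mult.commute sin_zero_abs_cos_one)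
      then show ?thesis by (simp add: sin_add abs_mult)
    qed
    moreover have "\<bar>pi * y\<bar> / 2 \<le> \<bar>sin (pi * y)\<bar>"
      using y1 by (intro abs_sin_ge_half_abs) (simp add: abs_mult)
    \<comment> \<open>As \<open>pi / 2 \<ge> 1\<close>, the factor 1/2 lost in the sine bound is
      regained and the constant stays \<open>c\<close>.\<close>
    moreover have "\<bar>y\<bar> \<le> \<bar>pi * y\<bar> / 2"
      using pi_ge_two mult_right_mono[of 2 pi "\<bar>y\<bar>"] by (simp add: abs_mult)
    ultimately show "c / real n \<le> \<bar>sin (real n * \<alpha>)\<bar>" using y2 by simp
  qed (rule c(1))
qed

text \<open>Dirichlet's theorem produces infinitely many denominators because \<open>sin (k \<alpha>)\<close> is bounded
  away from \<open>0\<close> as long as \<open>k\<close> is bounded.\<close>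

lemma infinitely_many_close_returns:
  assumes c: "c > 0" "\<And>n :: nat. n \<ge> 1 \<Longrightarrow> c / real n \<le> \<bar>sin (real n * \<alpha>)\<bar>"
  obtains n where "n \<ge> (M :: nat)" "n \<ge> 1" "1 - 2 * pi\<^sup>2 / (real n)\<^sup>2 \<le> cos (real n * \<alpha>)"
proof -
  \<comment> \<open>This makes \<open>2 pi / N < c / (M + 1)\<close>; since
    \<open>c / n \<le> |\<theta>| \<le> 2 pi / N\<close>, it forces
    \<open>n > M + 1\<close>.\<close>
  define N where "N = nat \<lceil>2 * pi * (real M + 1) / c\<rceil> + 1"
  have N: "real N > 2 * pi * (real M + 1) / c" unfolding N_def
    by linarith
  have N0: "real N > 0" by (simp add: N_def)
  have "N > 0" by (simp add: N_def)
  \<comment> \<open>Approximating \<open>\<alpha> / (2 pi)\<close> instead of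
    \<open>\<alpha> / pi\<close> brings the cosine close to 1 rather than -1.\<close>
  then obtain h k where k: "0 < k" "k \<le> int N" "\<bar>of_int k * (\<alpha> / (2 * pi)) - of_int h\<bar> < 1 / N"
    by (rule Dirichlet_approx[where \<theta> = "\<alpha> / (2 * pi)"])
  define n where "n = nat k"
  have n: "n \<ge> 1" "n \<le> N" "\<bar>n * (\<alpha> / (2 * pi)) - of_int h\<bar> < 1 / N"
    using k by (simp_all add: n_def)
  define \<theta> where "\<theta> = n * \<alpha> - 2 * pi * of_int h"
  have "\<theta> = 2 * pi * (n * (\<alpha> / (2 * pi)) - of_int h)" by (simp add: \<theta>_def field_simps)
  then have "\<bar>\<theta>\<bar> = 2 * pi * \<bar>n * (\<alpha> / (2 * pi)) - of_int h\<bar>" by (simp add: abs_mult)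
  also have "\<dots> \<le> 2 * pi * (1 / N)" using n(3) by (intro mult_left_mono) auto
  finally have th: "\<bar>\<theta>\<bar> \<le> 2 * pi / N" by simp
  have eq: "n * \<alpha> = \<theta> + 2 * pi * of_int h" by (simp add: \<theta>_def)
  have sin: "sin (n * \<alpha>) = sin \<theta>" and cos: "cos (n * \<alpha>) = cos \<theta>"
    unfolding eq by (simp_all add: sin_add cos_add)
  show thesis
  proof (rule that[of n])
    have "c / n \<le> \<bar>\<theta>\<bar>" using c(2)[OF n(1)] abs_sin_x_le_abs_x[of \<theta>] sin by simp
    also note th
    also have "2 * pi / N < c / (real M + 1)"
      using N c(1) N0 by (simp add: field_simps)
    finally have "c * (real M + 1) < c * real n" using n(1) c(1) by (simp add: field_simps)
    then have "real n > real M + 1" using c(1) by (simp only: mult_less_cancel_left_pos)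
    then show "n \<ge> M" by simp
    note th
    also have "2 * pi / N \<le> 2 * pi / n" using n(1,2) by (simp add: frac_le)
    finally have "\<bar>\<theta>\<bar> \<le> 2 * pi / n" .
    then have "\<bar>\<theta>\<bar>\<^sup>2 \<le> (2 * pi / n)\<^sup>2" by (intro power_mono) auto
    then have "\<theta>\<^sup>2 \<le> 4 * pi\<^sup>2 / (real n)\<^sup>2" by (simp add: power_divide power_mult_distrib)
    then show "1 - 2 * pi\<^sup>2 / (real n)\<^sup>2 \<le> cos (n * \<alpha>)"
      using cos_ge_one_minus_half_square[of \<theta>] cos by simp
  qed (rule n(1))
qed

section \<open>Upper bound by an invariant of all products\<close>

lemma A0_mult_vector [simp]:
  "(A0 *v x) $ 1 = x $ 1" "(A0 *v x) $ 2 = x $ 2" "(A0 *v x) $ 3 = 0"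
  by (simp_all add: A0_def matrix_vector_mult_def sum_3)

lemma A1_mult_vector [simp]:
  "(A1 \<alpha> *v x) $ 1 = x $ 1 + sin \<alpha> * x $ 2 + (cos \<alpha> - 1) * x $ 3"
  "(A1 \<alpha> *v x) $ 2 = cos \<alpha> * x $ 2 - sin \<alpha> * x $ 3"
  "(A1 \<alpha> *v x) $ 3 = sin \<alpha> * x $ 2 + cos \<alpha> * x $ 3"
  by (simp_all add: A1_def matrix_vector_mult_def sum_3)

text \<open>The first disjunct holds before the first projection; in the second one, \<open>\<rho>\<close> is the signed
  radius of \<open>(x\<^sub>2, x\<^sub>3)\<close> and \<open>n\<close> the number of rotations since the last projection. The length scale
  \<open>L\<close> is later set to \<open>N\<close> to the power \<open>1/3\<close>.\<close>

definition growth_invariant :: "real \<Rightarrow> real \<Rightarrow> real \<Rightarrow> nat \<Rightarrow> real^3 \<Rightarrow> bool" where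
  "growth_invariant \<alpha> c L t x \<longleftrightarrow>
     \<bar>x $ 1 - x $ 3\<bar> \<le> 2 \<and> (x $ 2)\<^sup>2 + (x $ 3)\<^sup>2 \<le> 1 \<or>
     (\<exists>\<rho> n. \<bar>\<rho>\<bar> \<le> 1 \<and> n \<le> t \<and> x $ 2 = \<rho> * cos (real n * \<alpha>) \<and> x $ 3 = \<rho> * sin (real n * \<alpha>) \<and>
        \<bar>x $ 1 - x $ 3\<bar> + 2 * L * \<bar>\<rho>\<bar> \<le> 3 + 2 * L + real (t - n) / (c * L\<^sup>2))"

text \<open>A rotation preserves \<open>x1 - x3\<close> and the radius; \<open>n\<close> and
  \<open>t\<close> advance together, so the allowance for \<open>t - n\<close> is unchanged.\<close>

lemma growth_invariant_A1:
  assumes "growth_invariant \<alpha> c L t x"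
  shows "growth_invariant \<alpha> c L (Suc t) (A1 \<alpha> *v x)"
proof -
  let ?y = "A1 \<alpha> *v x"
  have u: "?y $ 1 - ?y $ 3 = x $ 1 - x $ 3" by (simp add: algebra_simps)
  have "(?y $ 2)\<^sup>2 + (?y $ 3)\<^sup>2 = ((cos \<alpha>)\<^sup>2 + (sin \<alpha>)\<^sup>2) * ((x $ 2)\<^sup>2 + (x $ 3)\<^sup>2)"
    unfolding A1_mult_vector by algebra
  then have r: "(?y $ 2)\<^sup>2 + (?y $ 3)\<^sup>2 = (x $ 2)\<^sup>2 + (x $ 3)\<^sup>2" by simp
  from assms consider "\<bar>x $ 1 - x $ 3\<bar> \<le> 2" "(x $ 2)\<^sup>2 + (x $ 3)\<^sup>2 \<le> 1"
    | \<rho> n where "\<bar>\<rho>\<bar> \<le> 1" "n \<le> t" "x $ 2 = \<rho> * cos (real n * \<alpha>)" "x $ 3 = \<rho> * sin (real n * \<alpha>)"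
        "\<bar>x $ 1 - x $ 3\<bar> + 2 * L * \<bar>\<rho>\<bar> \<le> 3 + 2 * L + real (t - n) / (c * L\<^sup>2)"
    unfolding growth_invariant_def by blast
  then show ?thesis
  proof cases
    case 1
    then show ?thesis unfolding growth_invariant_def using u r by simp
  next
    case 2
    show ?thesis unfolding growth_invariant_def
    proof (intro disjI2 exI conjI)
      show "?y $ 2 = \<rho> * cos (real (Suc n) * \<alpha>)"
        by (simp add: 2 distrib_right cos_add algebra_simps)
      show "?y $ 3 = \<rho> * sin (real (Suc n) * \<alpha>)"
        by (simp add: 2 distrib_right sin_add algebra_simps)
      show "\<bar>?y $ 1 - ?y $ 3\<bar> + 2 * L * \<bar>\<rho>\<bar> \<le> 3 + 2 * L + real (Suc t - Suc n) / (c * L\<^sup>2)"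
        using 2(5) u by simp
    qed (use 2 in auto)
  qed
qed

text \<open>A projection after \<open>n\<close> rotations gains at most \<open>\<bar>sin (n \<alpha>)\<bar>\<close>. Either this is dominated by
  the loss of radius, which is at least half its square, or it is at most \<open>1 / L\<close>, and then
  \<open>n \<ge> c L\<close> pays for it.\<close>

lemma projection_gain:
  assumes c: "c > 0" "\<And>n :: nat. n \<ge> 1 \<Longrightarrow> c / real n \<le> \<bar>sin (real n * \<alpha>)\<bar>" and L: "L > 0"
  shows "\<bar>sin (real n * \<alpha>)\<bar> \<le> 2 * L * (1 - \<bar>cos (real n * \<alpha>)\<bar>) + real n / (c * L\<^sup>2)"
proof (cases "n = 0")
  case False
  define s where "s = \<bar>sin (real n * \<alpha>)\<bar>"
  define k where "k = \<bar>cos (real n * \<alpha>)\<bar>"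
  have s: "c / real n \<le> s" using c(2)[of n] False by (simp add: s_def)
  have s0: "s > 0" using s c(1) False by (smt (verit) divide_pos_pos of_nat_0_less_iff neq0_conv)
  have "s\<^sup>2 + k\<^sup>2 = 1" by (simp add: s_def k_def)
  then have "s\<^sup>2 = 2 * (1 - k) - (1 - k)\<^sup>2" by (simp add: power2_eq_square algebra_simps)
  then have k: "s\<^sup>2 \<le> 2 * (1 - k)" by simp
  have "s \<le> L * s\<^sup>2 + real n / (c * L\<^sup>2)"
  proof (cases "L * s \<ge> 1")
    case True
    then have "s \<le> L * s\<^sup>2" using mult_right_mono[OF True, of s] s0 by (simp add: power2_eq_square algebra_simps)
    also have "\<dots> \<le> L * s\<^sup>2 + real n / (c * L\<^sup>2)" using c(1) by simp
    finally show ?thesis .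
  next
    case small: False
    have "s * L \<le> 1" using small by (simp add: mult.commute)
    then have "(s * L)\<^sup>2 \<le> 1" using s0 L by (simp add: power_le_one)
    then have "s\<^sup>2 * L\<^sup>2 \<le> 1" by (simp add: power_mult_distrib)
    have cn: "c \<le> s * n" using s False by (simp add: field_simps)
    have "s * (c * L\<^sup>2) \<le> s * (s * n * L\<^sup>2)" using cn s0 by (intro mult_left_mono mult_right_mono) auto
    also have "\<dots> = n * (s\<^sup>2 * L\<^sup>2)" by (simp add: power2_eq_square algebra_simps)
    also have "\<dots> \<le> real n * 1" using \<open>s\<^sup>2 * L\<^sup>2 \<le> 1\<close> by (intro mult_left_mono) auto
    finally have "s \<le> n / (c * L\<^sup>2)" using c L by (simp add: field_simps)
    then show ?thesis using L by (simp add: add_increasing)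
  qed
  also have "\<dots> \<le> L * (2 * (1 - k)) + real n / (c * L\<^sup>2)" using k L by simp
  finally show ?thesis by (simp add: s_def k_def algebra_simps)
qed simp

text \<open>\<open>projection_gain\<close>, scaled by \<open>|\<rho>| \<le> 1\<close>, charges the
  gain to the drop of \<open>2 L |\<rho>|\<close> and to the \<open>n\<close> rotations. The counter
  restarts at 0, which releases the allowance for these rotations.\<close>

lemma growth_invariant_A0:
  assumes c: "c > 0" "\<And>n :: nat. n \<ge> 1 \<Longrightarrow> c / real n \<le> \<bar>sin (real n * \<alpha>)\<bar>" and L: "L > 0"
    and inv: "growth_invariant \<alpha> c L t x"
  shows "growth_invariant \<alpha> c L (Suc t) (A0 *v x)"
proof -
  from inv consider "\<bar>x $ 1 - x $ 3\<bar> \<le> 2" "(x $ 2)\<^sup>2 + (x $ 3)\<^sup>2 \<le> 1"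
    | \<rho> n where "\<bar>\<rho>\<bar> \<le> 1" "n \<le> t" "x $ 2 = \<rho> * cos (real n * \<alpha>)" "x $ 3 = \<rho> * sin (real n * \<alpha>)"
        "\<bar>x $ 1 - x $ 3\<bar> + 2 * L * \<bar>\<rho>\<bar> \<le> 3 + 2 * L + real (t - n) / (c * L\<^sup>2)"
    unfolding growth_invariant_def by blast
  then show ?thesis
  proof cases
    case 1
    have "(x $ 2)\<^sup>2 \<le> 1" "(x $ 3)\<^sup>2 \<le> 1" using 1(2) by (smt (verit) zero_le_power2)+
    then have x: "\<bar>x $ 2\<bar> \<le> 1" "\<bar>x $ 3\<bar> \<le> 1" by (simp_all add: abs_square_le_1)
    show ?thesis unfolding growth_invariant_def
    \<comment> \<open>At the first projection \<open>|x1| \<le> 2 + 1\<close> and the radius is at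
      most 1: this is the source of \<open>3 + 2 * L\<close>.\<close>
    proof (rule disjI2, rule exI[of _ "x $ 2"], rule exI[of _ 0], intro conjI)
      have "2 * L * \<bar>x $ 2\<bar> \<le> 2 * L" using x(1) L by simp
      moreover have "real (Suc t) / (c * L\<^sup>2) \<ge> 0" using c by simp
      moreover have "\<bar>x $ 1\<bar> \<le> 3" using 1(1) x(2) by linarith
      ultimately show "\<bar>(A0 *v x) $ 1 - (A0 *v x) $ 3\<bar> + 2 * L * \<bar>x $ 2\<bar>
        \<le> 3 + 2 * L + real (Suc t - 0) / (c * L\<^sup>2)" by simp
    qed (use x in auto)
  next
    case 2
    let ?k = "cos (real n * \<alpha>)" and ?s = "sin (real n * \<alpha>)"
    show ?thesis unfolding growth_invariant_def
    proof (rule disjI2, rule exI[of _ "\<rho> * ?k"], rule exI[of _ 0], intro conjI)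
      show "\<bar>\<rho> * ?k\<bar> \<le> 1" using 2(1) by (simp add: abs_mult mult_le_one)
      have "\<bar>\<rho>\<bar> * \<bar>?s\<bar> \<le> \<bar>\<rho>\<bar> * (2 * L * (1 - \<bar>?k\<bar>) + real n / (c * L\<^sup>2))"
        using projection_gain[OF c L] by (intro mult_left_mono) auto
      also have "\<dots> \<le> 2 * L * \<bar>\<rho>\<bar> - 2 * L * \<bar>\<rho> * ?k\<bar> + 1 * (real n / (c * L\<^sup>2))"
        unfolding distrib_left using c 2(1)
        by (intro add_mono mult_right_mono) (auto simp: abs_mult algebra_simps)
      finally have "\<bar>x $ 3\<bar> \<le> 2 * L * \<bar>\<rho>\<bar> - 2 * L * \<bar>\<rho> * ?k\<bar> + real n / (c * L\<^sup>2)"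
        by (simp add: 2 abs_mult)
      moreover have "\<bar>x $ 1\<bar> \<le> \<bar>x $ 1 - x $ 3\<bar> + \<bar>x $ 3\<bar>" by simp
      ultimately have "\<bar>x $ 1\<bar> + 2 * L * \<bar>\<rho> * ?k\<bar>
          \<le> 3 + 2 * L + (real (t - n) / (c * L\<^sup>2) + real n / (c * L\<^sup>2))" using 2(5) by linarith
      also have "real (t - n) / (c * L\<^sup>2) + real n / (c * L\<^sup>2) = real t / (c * L\<^sup>2)"
        using 2(2) by (simp add: of_nat_diff flip: add_divide_distrib)
      also have "\<dots> \<le> real (Suc t) / (c * L\<^sup>2)" using c by (simp add: divide_right_mono)
      finally show "\<bar>(A0 *v x) $ 1 - (A0 *v x) $ 3\<bar> + 2 * L * \<bar>\<rho> * ?k\<bar>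
        \<le> 3 + 2 * L + real (Suc t - 0) / (c * L\<^sup>2)" by simp
    qed (auto simp: 2)
  qed
qed

lemma growth_invariant_initial:
  assumes "norm x \<le> 1"
  shows "growth_invariant \<alpha> c L t x"
proof -
  have "norm x ^ 2 \<le> 1" using assms by (simp add: power_le_one)
  then have "(x $ 1)\<^sup>2 + (x $ 2)\<^sup>2 + (x $ 3)\<^sup>2 \<le> 1"
    by (simp add: norm_vec_def L2_set_def sum_3 sum_nonneg)
  then have "(x $ 2)\<^sup>2 + (x $ 3)\<^sup>2 \<le> 1" by (smt (verit) zero_le_power2)
  moreover have "\<bar>x $ 1 - x $ 3\<bar> \<le> 2"
    using component_le_norm_cart[of x 1] component_le_norm_cart[of x 3] assms by linarith
  ultimately show ?thesis by (simp add: growth_invariant_def)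
qed

lemma growth_invariant_norm_le:
  assumes c: "c > 0" and L: "L > 0" and "growth_invariant \<alpha> c L t x"
  shows "norm x \<le> 6 + 2 * L + real t / (c * L\<^sup>2)"
proof -
  \<comment> \<open>Bounding \<open>x1\<close> by \<open>x1 - x3\<close> counts \<open>x3\<close>
    twice, so 6 arises as 3 from the invariant plus 1 + 2.\<close>
  have n: "norm x \<le> \<bar>x $ 1 - x $ 3\<bar> + \<bar>x $ 2\<bar> + 2 * \<bar>x $ 3\<bar>"
    using norm_le_l1_cart[of x] by (simp add: sum_3)
  from assms(3) consider "\<bar>x $ 1 - x $ 3\<bar> \<le> 2" "(x $ 2)\<^sup>2 + (x $ 3)\<^sup>2 \<le> 1"
    | \<rho> n where "\<bar>\<rho>\<bar> \<le> 1" "n \<le> t" "x $ 2 = \<rho> * cos (real n * \<alpha>)" "x $ 3 = \<rho> * sin (real n * \<alpha>)"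
        "\<bar>x $ 1 - x $ 3\<bar> + 2 * L * \<bar>\<rho>\<bar> \<le> 3 + 2 * L + real (t - n) / (c * L\<^sup>2)"
    unfolding growth_invariant_def by blast
  then show ?thesis
  proof cases
    case 1
    have "(x $ 2)\<^sup>2 \<le> 1" "(x $ 3)\<^sup>2 \<le> 1" using 1(2) by (smt (verit) zero_le_power2)+
    then have x: "\<bar>x $ 2\<bar> \<le> 1" "\<bar>x $ 3\<bar> \<le> 1" by (simp_all add: abs_square_le_1)
    moreover have "real t / (c * L\<^sup>2) \<ge> 0" using c by simp
    ultimately show ?thesis using 1(1) n L by linarith
  next
    case 2
    have "\<bar>x $ 2\<bar> \<le> 1" "\<bar>x $ 3\<bar> \<le> 1" using 2(1) by (simp_all add: 2 abs_mult mult_le_one)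
    moreover have "real (t - n) / (c * L\<^sup>2) \<le> real t / (c * L\<^sup>2)" 
      using c by (intro divide_right_mono) auto
    moreover have "2 * L * \<bar>\<rho>\<bar> \<ge> 0" using L by simp
    ultimately show ?thesis using 2(5) n by linarith
  qed
qed

lemma matrix_prod_cube_root_bound:
  assumes "quadratic_irrational (\<alpha> / pi)"
  obtains C where "C > 0"
    "\<And>A N. N \<ge> 1 \<Longrightarrow> \<forall>j\<in>{1..N}. A j \<in> matrix_family \<alpha> \<Longrightarrow>
       onorm ((*v) (matrix_prod A N)) \<le> C * real N powr (1/3)"
proof -
  obtain c where c: "c > 0" "\<And>n :: nat. n \<ge> 1 \<Longrightarrow> c / real n \<le> \<bar>sin (real n * \<alpha>)\<bar>"
    using abs_sin_mult_ge[OF assms] by metis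
  show thesis
  proof (rule that[of "8 + 1 / c"])
    show "8 + 1 / c > 0" using c by (simp add: add_pos_pos)
    fix A and N :: nat
    assume N: "N \<ge> 1" and A: "\<forall>j\<in>{1..N}. A j \<in> matrix_family \<alpha>"
    \<comment> \<open>\<open>L^3 = N\<close> balances the terms \<open>2 L\<close> and
      \<open>N / (c L^2) = L / c\<close>. The scale is set by the final length and stays fixed
      during the induction on \<open>k\<close>.\<close>
    define L where "L = real N powr (1/3)"
    have L: "L \<ge> 1" using N by (simp add: L_def ge_one_powr_ge_zero)
    have "L * L\<^sup>2 = L powr 3" using L by (simp add: powr_numeral power3_eq_cube power2_eq_square)
    also have "\<dots> = real N" using N by (simp add: L_def powr_powr)
    finally have L3: "real N = L * L\<^sup>2" by simp
    have unit: "norm (matrix_prod A N *v x) \<le> (8 + 1 / c) * L" if x: "norm x \<le> 1" for x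
    proof -
      have "growth_invariant \<alpha> c L k (matrix_prod A k *v x)" if "k \<le> N" for k
        using that
      proof (induction k)
        case 0
        show ?case using growth_invariant_initial[OF x] by simp
      next
        case (Suc k)
        have "A (Suc k) \<in> {A0, A1 \<alpha>}" using A Suc.prems by (auto simp: matrix_family_def)
        then show ?case
          using growth_invariant_A0[OF c, of L k "matrix_prod A k *v x"] L
            growth_invariant_A1[of \<alpha> c L k "matrix_prod A k *v x"] Suc
          by (auto simp flip: matrix_vector_mul_assoc)
      qed
      then have "growth_invariant \<alpha> c L N (matrix_prod A N *v x)" by simp
      then have "norm (matrix_prod A N *v x) \<le> 6 + 2 * L + real N / (c * L\<^sup>2)"
        using c L by (intro growth_invariant_norm_le) auto
      also have "real N / (c * L\<^sup>2) = 1 / c * L" using L by (simp add: L3)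
      also have "6 + 2 * L + 1 / c * L \<le> (8 + 1 / c) * L" using L by (simp add: algebra_simps)
      finally show ?thesis .
    qed
    show "onorm ((*v) (matrix_prod A N)) \<le> (8 + 1 / c) * real N powr (1/3)"
    proof (rule onorm_le)
      fix x :: "real^3"
      show "norm (matrix_prod A N *v x) \<le> (8 + 1 / c) * real N powr (1/3) * norm x"
      proof (cases "x = 0")
        case False
        have "norm (matrix_prod A N *v ((1 / norm x) *\<^sub>R x)) \<le> (8 + 1 / c) * L"
          by (rule unit) (use False in simp)
        then show ?thesis using False
          by (simp add: matrix_vector_mult_scaleR field_simps flip: L_def)
      qed simp
    qed
  qed
qed

section \<open>Passage to the maximum\<close>

text \<open>Infinitely many \<open>A\<close> share finitely many products, as each product is an
  element of \<open>S\<close> times a shorter product.\<close>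

lemma finite_matrix_prods:
  fixes S :: "(real^'n^'n) set"
  assumes "finite S"
  shows "finite {matrix_prod A N | A. \<forall>j\<in>{1..N}. A j \<in> S}"
proof (induction N)
  case (Suc N)
  have "{matrix_prod A (Suc N) | A. \<forall>j\<in>{1..Suc N}. A j \<in> S}
      \<subseteq> (\<lambda>(B, P). B ** P) ` (S \<times> {matrix_prod A N | A. \<forall>j\<in>{1..N}. A j \<in> S})"
    by force
  then show ?case using Suc assms by (meson finite_SigmaI finite_imageI finite_subset)
qed simp

lemma max_growth_le:
  fixes S :: "(real^'n^'n) set"
  assumes "finite S" "S \<noteq> {}"
    and "\<And>A. \<forall>j\<in>{1..N}. A j \<in> S \<Longrightarrow> onorm ((*v) (matrix_prod A N)) \<le> C"
  shows "max_growth S N \<le> C"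
  unfolding max_growth_def
proof (rule Max.boundedI)
  have "{onorm ((*v) (matrix_prod A N)) | A. \<forall>j\<in>{1..N}. A j \<in> S}
      = (\<lambda>P. onorm ((*v) P)) ` {matrix_prod A N | A. \<forall>j\<in>{1..N}. A j \<in> S}" by auto
  then show "finite {onorm ((*v) (matrix_prod A N)) | A. \<forall>j\<in>{1..N}. A j \<in> S}"
    using finite_matrix_prods[OF assms(1)] by simp
  show "{onorm ((*v) (matrix_prod A N)) | A. \<forall>j\<in>{1..N}. A j \<in> S} \<noteq> {}"
    using assms(2) by auto
qed (use assms(3) in auto)

section \<open>Trajectories made of blocks of rotations and a projection\<close>

lemma trajectory_cong:
  assumes "\<And>k. k < T \<Longrightarrow> A k = B k"
  shows "trajectory A x0 T = trajectory B x0 T"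
  using assms by (induction T) auto

text \<open>The shift reconciles the two indexings: trajectories start with \<open>A 0\<close>,
  products with \<open>A 1\<close>.\<close>

lemma trajectory_eq_matrix_prod:
  "trajectory A x0 N = matrix_prod (\<lambda>j. A (j - 1)) N *v x0"
  by (induction N) (simp_all add: matrix_vector_mul_assoc)

lemma trajectory_rotations:
  assumes "trajectory A x0 T $ 3 = 0" "\<And>i. i < n \<Longrightarrow> A (T + i) = A1 \<alpha>"
  shows "trajectory A x0 (T + n) $ 1 = trajectory A x0 T $ 1 + trajectory A x0 (T + n) $ 3 \<and>
    trajectory A x0 (T + n) $ 2 = trajectory A x0 T $ 2 * cos (real n * \<alpha>) \<and>
    trajectory A x0 (T + n) $ 3 = trajectory A x0 T $ 2 * sin (real n * \<alpha>)"
  using assms(2)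
proof (induction n)
  case 0
  then show ?case using assms(1) by simp
next
  case (Suc n)
  then have "A (T + n) = A1 \<alpha>" by blast
  then show ?case using Suc.IH[OF Suc.prems[OF less_SucI]]
    by (simp add: distrib_right sin_add cos_add algebra_simps)
qed

lemma trajectory_block:
  assumes "trajectory A x0 T $ 3 = 0" "\<And>i. i < n \<Longrightarrow> A (T + i) = A1 \<alpha>" "A (T + n) = A0"
  shows "trajectory A x0 (T + n + 1) $ 1 = trajectory A x0 T $ 1 + trajectory A x0 T $ 2 * sin (real n * \<alpha>)"
    and "trajectory A x0 (T + n + 1) $ 2 = trajectory A x0 T $ 2 * cos (real n * \<alpha>)"
    and "trajectory A x0 (T + n + 1) $ 3 = 0"
  using trajectory_rotations[OF assms(1,2)] assms(3) by simp_all

text \<open>Each block returns to the plane \<open>x3 = 0\<close>, adds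
  \<open>sin (n \<alpha>)\<close> times the current \<open>x2\<close> to \<open>x1\<close> and
  multiplies \<open>x2\<close> by \<open>cos (n \<alpha>)\<close>; the gains form a geometric
  series.\<close>

lemma trajectory_blocks:
  assumes "trajectory A x0 T $ 3 = 0"
    and "\<And>j i. j < k \<Longrightarrow> i < n \<Longrightarrow> A (T + j * (n + 1) + i) = A1 \<alpha>"
    and "\<And>j. j < k \<Longrightarrow> A (T + j * (n + 1) + n) = A0"
  shows "trajectory A x0 (T + k * (n + 1)) $ 1 = trajectory A x0 T $ 1 +
      trajectory A x0 T $ 2 * sin (real n * \<alpha>) * (\<Sum>j<k. cos (real n * \<alpha>) ^ j) \<and>
    trajectory A x0 (T + k * (n + 1)) $ 2 = trajectory A x0 T $ 2 * cos (real n * \<alpha>) ^ k \<and>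
    trajectory A x0 (T + k * (n + 1)) $ 3 = 0"
  using assms(2,3)
proof (induction k)
  case 0
  then show ?case using assms(1) by simp
next
  case (Suc k)
  have eq: "T + Suc k * (n + 1) = T + k * (n + 1) + n + 1" by simp
  have IH: "trajectory A x0 (T + k * (n + 1)) $ 1 = trajectory A x0 T $ 1 +
      trajectory A x0 T $ 2 * sin (real n * \<alpha>) * (\<Sum>j<k. cos (real n * \<alpha>) ^ j)"
    "trajectory A x0 (T + k * (n + 1)) $ 2 = trajectory A x0 T $ 2 * cos (real n * \<alpha>) ^ k"
    "trajectory A x0 (T + k * (n + 1)) $ 3 = 0"
    using Suc.IH[OF Suc.prems(1)[OF less_SucI] Suc.prems(2)[OF less_SucI]] by auto
  note block = trajectory_block[of A x0 "T + k * (n + 1)" n \<alpha>, OF IH(3) Suc.prems(1)[OF lessI] Suc.prems(2)[OF lessI]]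
  show ?case unfolding eq using block IH(1,2)
    by (simp only: sum.lessThan_Suc power_Suc) (simp add: algebra_simps)
qed

text \<open>From \<open>ln (1 - x) \<ge> -2 x\<close> for small \<open>x\<close>: a relative loss of
  \<open>w / m^2\<close> per block leaves a fixed proportion after \<open>m^2\<close> blocks. It is
  applied with \<open>y = cos (n \<alpha>)\<close>.\<close>

lemma power_square_bounded_below:
  fixes y :: real
  assumes "2 * w \<le> m\<^sup>2" "m > 0" "w \<ge> 0" "1 - w / m\<^sup>2 \<le> y" "k \<le> m\<^sup>2"
  shows "exp (- 2 * w) \<le> y ^ k"
proof -
  define x where "x = w / m\<^sup>2"
  have x: "0 \<le> x" "x \<le> 1 / 2" using assms by (simp_all add: x_def field_simps)
  have "x * (2 * x) \<le> x * 1" using x by (intro mult_left_mono) auto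
  then have "- 2 * x \<le> - x - 2 * x\<^sup>2" by (simp add: power2_eq_square)
  also have "\<dots> \<le> ln (1 - x)" using x by (intro ln_one_minus_pos_lower_bound) auto
  finally have "exp (- 2 * x) \<le> 1 - x" using x by (simp add: ln_ge_iff)
  then have y: "exp (- 2 * x) \<le> y" using assms(4) by (simp add: x_def)
  have "real k * x \<le> m\<^sup>2 * x" using x assms(5) by (intro mult_right_mono) auto
  also have "m\<^sup>2 * x = w" using assms(2) by (simp add: x_def)
  finally have "exp (- 2 * w) \<le> exp (real k * (- 2 * x))" by simp
  also have "\<dots> = exp (- 2 * x) ^ k" by (rule exp_of_nat_mult)
  also have "\<dots> \<le> y ^ k" using y by (intro power_mono) auto
  finally show ?thesis .
qed

text \<open>One stage of the construction. It ends in the plane \<open>x3 = 0\<close> with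
  \<open>x2\<close> nonzero, so another stage can follow.\<close>

lemma trajectory_extension:
  assumes c: "c > 0" "\<And>n :: nat. n \<ge> 1 \<Longrightarrow> c / real n \<le> \<bar>sin (real n * \<alpha>)\<bar>"
    and A: "\<And>k. A k \<in> matrix_family \<alpha>"
    and x: "trajectory A x0 T $ 3 = 0" "trajectory A x0 T $ 2 \<noteq> 0"
    and e: "e < 1 / 3"
  obtains A' T' where "T < T'" "\<And>k. k < T \<Longrightarrow> A' k = A k" "\<And>k. A' k \<in> matrix_family \<alpha>"
    "trajectory A' x0 T' $ 3 = 0" "trajectory A' x0 T' $ 2 \<noteq> 0"
    "e < ln (norm (trajectory A' x0 T')) / ln (real T')"
proof -
  define b where "b = trajectory A x0 T $ 2"
  define E where "E = \<bar>trajectory A x0 T $ 1\<bar>"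
  \<comment> \<open>Each of the \<open>n^2\<close> blocks gains at least
    \<open>|b| (c / n) exp (- 4 pi^2)\<close>, in total \<open>D n\<close>; the earlier first
    coordinate can cancel at most \<open>E\<close>.\<close>
  define D where "D = \<bar>b\<bar> * c * exp (- 2 * (2 * pi\<^sup>2))"
  have D: "D > 0" using x c by (simp add: D_def b_def)
  \<comment> \<open>Norm of order at least \<open>n\<close> at time of order \<open>n^3\<close>:
    hence the exponent 1/3, whatever \<open>T\<close> and \<open>E\<close> are.\<close>
  have "((\<lambda>n :: nat. ln (D * real n - E) / ln (real T + (real n)\<^sup>2 * (real n + 1))) \<longlongrightarrow> 1 / 3) at_top"
    using D by real_asymp
  then have "\<forall>\<^sub>F n :: nat in at_top. e < ln (D * real n - E) / ln (real T + (real n)\<^sup>2 * (real n + 1))"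
    using e by (rule order_tendstoD)
  moreover have "\<forall>\<^sub>F n :: nat in at_top. 0 < D * real n - E" using D by real_asymp
  moreover have "\<forall>\<^sub>F n :: nat in at_top. 2 * (2 * pi\<^sup>2) \<le> (real n)\<^sup>2" by real_asymp
  ultimately have "\<forall>\<^sub>F n :: nat in at_top. e < ln (D * real n - E) / ln (real T + (real n)\<^sup>2 * (real n + 1))
     \<and> 0 < D * real n - E \<and> 2 * (2 * pi\<^sup>2) \<le> (real n)\<^sup>2"
    by (intro eventually_conj)
  then obtain M where M: "\<And>n. n \<ge> M \<Longrightarrow> e < ln (D * real n - E) / ln (real T + (real n)\<^sup>2 * (real n + 1))
     \<and> 0 < D * real n - E \<and> 2 * (2 * pi\<^sup>2) \<le> (real n)\<^sup>2"
    unfolding eventually_sequentially by blast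
  obtain n where n: "n \<ge> M" "n \<ge> 1" "1 - 2 * pi\<^sup>2 / (real n)\<^sup>2 \<le> cos (real n * \<alpha>)"
    using infinitely_many_close_returns[OF c] by metis
  define k where "k = n\<^sup>2"
  define T' where "T' = T + k * (n + 1)"
  \<comment> \<open>A block has length \<open>n + 1\<close>, and residue \<open>n\<close> marks its
    last step, the projection.\<close>
  define A' where "A' i = (if i < T then A i else if (i - T) mod (n + 1) = n then A0 else A1 \<alpha>)" for i
  have pow: "exp (- 2 * (2 * pi\<^sup>2)) \<le> cos (real n * \<alpha>) ^ j" if "j \<le> k" for j
  proof (rule power_square_bounded_below[where m = "real n"])
    have "real j \<le> real k" using that by simp
    then show "real j \<le> (real n)\<^sup>2" by (simp add: k_def)
  qed (use M[OF n(1)] n in auto)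
  have same: "trajectory A' x0 T = trajectory A x0 T"
    by (rule trajectory_cong) (simp add: A'_def)
  have rot: "A' (T + j * (n + 1) + i) = A1 \<alpha>" if "i < n" for j i
  proof -
    have "(j * (n + 1) + i) mod (n + 1) = i" using that by (simp only: mod_mult_self3 mod_less)
    then show ?thesis using that unfolding A'_def by (simp add: add.assoc)
  qed
  have proj: "A' (T + j * (n + 1) + n) = A0" for j
  proof -
    have "(j * (n + 1) + n) mod (n + 1) = n" by (simp only: mod_mult_self3 mod_less)
    then show ?thesis unfolding A'_def by (simp add: add.assoc)
  qed
  have x': "trajectory A' x0 T $ 3 = 0" using x same by simp
  have blocks: "trajectory A' x0 T' $ 1 = trajectory A x0 T $ 1 + b * sin (real n * \<alpha>) * (\<Sum>j<k. cos (real n * \<alpha>) ^ j)"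
    "trajectory A' x0 T' $ 2 = b * cos (real n * \<alpha>) ^ k" "trajectory A' x0 T' $ 3 = 0"
    using trajectory_blocks[of A' x0 T k n \<alpha>, OF x' rot proj] by (simp_all add: T'_def same b_def)
  show thesis
  proof (rule that)
    show "T < T'" using n by (simp add: T'_def k_def)
    show "A' i = A i" if "i < T" for i using that by (simp add: A'_def)
    show "A' i \<in> matrix_family \<alpha>" for i using A by (simp add: A'_def matrix_family_def)
    show "trajectory A' x0 T' $ 3 = 0" by (rule blocks(3))
    have "0 < cos (real n * \<alpha>) ^ k" using pow[of k] by (smt (verit) exp_gt_zero order_refl)
    then show "trajectory A' x0 T' $ 2 \<noteq> 0" using blocks(2) x unfolding b_def
      by (metis less_irrefl mult_eq_0_iff)
    \<comment> \<open>The powers of the cosine are positive, so all gains have the same sign and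
      cannot cancel.\<close>
    have "D * real n = \<bar>b\<bar> * (c / real n) * (real k * exp (- 2 * (2 * pi\<^sup>2)))"
      using n by (simp add: D_def k_def power2_eq_square)
    also have "\<dots> \<le> \<bar>b\<bar> * \<bar>sin (real n * \<alpha>)\<bar> * (\<Sum>j<k. cos (real n * \<alpha>) ^ j)"
    proof (intro mult_mono mult_nonneg_nonneg)
      show "real k * exp (- 2 * (2 * pi\<^sup>2)) \<le> (\<Sum>j<k. cos (real n * \<alpha>) ^ j)"
        using sum_bounded_below[of "{..<k}" "exp (- 2 * (2 * pi\<^sup>2))" "\<lambda>j. cos (real n * \<alpha>) ^ j"] pow
        by simp
    qed (use c n in auto)
    also have "\<dots> \<le> \<bar>b * sin (real n * \<alpha>) * (\<Sum>j<k. cos (real n * \<alpha>) ^ j)\<bar>"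
      unfolding abs_mult by (intro mult_left_mono) auto
    also have "\<dots> \<le> \<bar>trajectory A' x0 T' $ 1\<bar> + E" unfolding E_def using blocks(1) by linarith
    also have "\<bar>trajectory A' x0 T' $ 1\<bar> \<le> norm (trajectory A' x0 T')" by (rule component_le_norm_cart)
    finally have "ln (D * real n - E) \<le> ln (norm (trajectory A' x0 T'))"
      using M[OF n(1)] by (subst ln_le_cancel_iff) auto
    moreover have T'_eq: "real T + (real n)\<^sup>2 * (real n + 1) = real T'"
      by (simp add: T'_def k_def algebra_simps)
    moreover have "ln (real T') \<ge> 0"
      using \<open>T < T'\<close> by simp
    ultimately show "e < ln (norm (trajectory A' x0 T')) / ln (real T')"
      using M[OF n(1)] by (smt (verit) divide_right_mono)
  qed
qed

section \<open>Growth exponents and concatenation of stages\<close>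

lemma growth_exponent_le:
  assumes "C > 0" "p \<ge> 0" "\<And>N. N \<ge> 1 \<Longrightarrow> norm (x N) \<le> C * real N powr p"
  shows "growth_exponent x \<le> ereal p"
proof -
  \<comment> \<open>\<open>ln C' \<ge> 0\<close> makes the logarithmic bound hold also where
    \<open>x N = 0\<close>, since \<open>ln 0 = 0\<close>.\<close>
  define C' where "C' = max C 1"
  have le: "ln (norm (x N)) / ln (real N) \<le> ln C' / ln (real N) + p" if N: "N \<ge> 2" for N
  proof -
    have lnN: "ln (real N) > 0" using N by simp
    have "ln (norm (x N)) \<le> ln C' + p * ln (real N)"
    proof (cases "x N = 0")
      case True
      then show ?thesis using lnN assms(2) by (simp add: C'_def)
    next
      case False
      have "norm (x N) \<le> C * real N powr p" using assms(3) N by simp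
      also have "\<dots> \<le> C' * real N powr p" by (intro mult_right_mono) (auto simp: C'_def)
      finally have "ln (norm (x N)) \<le> ln (C' * real N powr p)"
        using False N by (subst ln_le_cancel_iff) (auto simp: C'_def max_def)
      also have "\<dots> = ln C' + p * ln (real N)"
        using N by (subst ln_mult) (auto simp: C'_def ln_powr)
      finally show ?thesis .
    qed
    then show ?thesis using lnN by (simp add: field_simps)
  qed
  have "growth_exponent x \<le> limsup (\<lambda>N. ereal (ln C' / ln (real N) + p))"
    unfolding growth_exponent_def
    using le by (intro Limsup_mono eventually_sequentiallyI[of 2]) simp
  also have "((\<lambda>N. ln C' / ln (real N) + p) \<longlongrightarrow> p) sequentially"
    by real_asymp
  then have "limsup (\<lambda>N. ereal (ln C' / ln (real N) + p)) = ereal p"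
    by (intro lim_imp_Limsup) auto
  finally show ?thesis .
qed

lemma growth_exponent_ge:
  assumes "strict_mono T" "f \<longlonglongrightarrow> p" "\<And>m. f m \<le> ln (norm (x (T m))) / ln (real (T m))"
  shows "ereal p \<le> growth_exponent x"
proof -
  have "ereal p = limsup (\<lambda>m. ereal (f m))"
    using assms(2) by (intro lim_imp_Limsup[symmetric]) auto
  also have "\<dots> \<le> limsup ((\<lambda>N. ereal (ln (norm (x N)) / ln (real N))) \<circ> T)"
    using assms(3) by (intro Limsup_mono) auto
  also have "\<dots> \<le> growth_exponent x"
    unfolding growth_exponent_def using assms(1) by (rule limsup_subseq_mono)
  finally show ?thesis .
qed

text \<open>Stage \<open>m\<close> exceeds the exponent \<open>1/3 - 1/(m + 1)\<close> at its end
  and keeps all earlier matrices, so the sequences stabilise pointwise to a single one.\<close>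

lemma trajectory_growth_exponent_ge:
  assumes c: "c > 0" "\<And>n :: nat. n \<ge> 1 \<Longrightarrow> c / real n \<le> \<bar>sin (real n * \<alpha>)\<bar>"
  obtains A x0 where "\<And>k. A k \<in> matrix_family \<alpha>" "ereal (1 / 3) \<le> growth_exponent (trajectory A x0)"
proof -
  define x0 :: "real^3" where "x0 = vector [0, 1, 0]"
  define good where "good S \<longleftrightarrow> (\<forall>k. fst S k \<in> matrix_family \<alpha>) \<and>
      trajectory (fst S) x0 (snd S) $ 3 = 0 \<and> trajectory (fst S) x0 (snd S) $ 2 \<noteq> 0"
    for S :: "(nat \<Rightarrow> real^3^3) \<times> nat"
  define ext where "ext m S S' \<longleftrightarrow> snd S < snd S' \<and> (\<forall>k<snd S. fst S' k = fst S k) \<and>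
      1 / 3 - 1 / (real m + 1) < ln (norm (trajectory (fst S') x0 (snd S'))) / ln (real (snd S'))"
    for m :: nat and S S' :: "(nat \<Rightarrow> real^3^3) \<times> nat"
  have "\<exists>F. \<forall>m. good (F m) \<and> ext m (F m) (F (Suc m))"
  proof (rule dependent_nat_choice)
    show "\<exists>S. good S"
      by (rule exI[of _ "(\<lambda>_. A0, 0)"]) (simp add: good_def matrix_family_def x0_def)
    fix S and m :: nat
    assume S: "good S"
    show "\<exists>S'. good S' \<and> ext m S S'"
    proof (rule trajectory_extension[OF c, of "fst S" x0 "snd S" "1 / 3 - 1 / (real m + 1)"])
      fix A' T'
      assume "snd S < T'" "\<And>k. k < snd S \<Longrightarrow> A' k = fst S k" "\<And>k. A' k \<in> matrix_family \<alpha>"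
        "trajectory A' x0 T' $ 3 = 0" "trajectory A' x0 T' $ 2 \<noteq> 0"
        "1 / 3 - 1 / (real m + 1) < ln (norm (trajectory A' x0 T')) / ln (real T')"
      then have "good (A', T') \<and> ext m S (A', T')" by (simp add: good_def ext_def)
      then show ?thesis by blast
    qed (use S in \<open>auto simp: good_def\<close>)
  qed
  then obtain F where F: "\<And>m. good (F m)" "\<And>m. ext m (F m) (F (Suc m))" by metis
  define T where "T m = snd (F m)" for m
  have T: "strict_mono T"
    using F(2) by (auto intro!: strict_monoI_Suc simp: T_def ext_def)
  have agree: "fst (F (m + d)) k = fst (F m) k" if "k < T m" for m d k
  proof (induction d)
    case (Suc d)
    have "k < T (m + d)" using that T by (meson le_add1 less_le_trans strict_mono_less_eq)
    then show ?case using Suc F(2)[of "m + d"] by (simp add: T_def ext_def)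
  qed simp
  \<comment> \<open>\<open>T\<close> is strictly increasing, so \<open>k < T (Suc k)\<close> and
    entry \<open>k\<close> is final by then.\<close>
  define A where "A k = fst (F (Suc k)) k" for k
  have A_eq: "A k = fst (F m) k" if "k < T m" for k m
  proof -
    have "k < T (Suc k)" using seq_suble[OF T, of "Suc k"] by simp
    then show ?thesis using agree[of k m "Suc k - m"] agree[of k "Suc k" "m - Suc k"] that
      unfolding A_def by (cases "m \<le> Suc k") auto
  qed
  show thesis
  proof (rule that)
    show "A k \<in> matrix_family \<alpha>" for k using F(1) by (simp add: A_def good_def)
    show "ereal (1 / 3) \<le> growth_exponent (trajectory A x0)"
    proof (rule growth_exponent_ge)
      show "strict_mono (\<lambda>m. T (Suc m))" using T by (simp add: strict_mono_def)
      show "(\<lambda>m. 1 / 3 - 1 / (real m + 1)) \<longlonglongrightarrow> 1 / 3" by real_asymp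
      fix m
      have "trajectory A x0 (T (Suc m)) = trajectory (fst (F (Suc m))) x0 (T (Suc m))"
        by (rule trajectory_cong) (rule A_eq)
      then show "1 / 3 - 1 / (real m + 1) \<le> ln (norm (trajectory A x0 (T (Suc m)))) / ln (real (T (Suc m)))"
        using F(2)[of m] by (simp add: ext_def T_def)
    qed
  qed
qed

theorem theorem2:
  fixes \<alpha> :: real
  assumes "quadratic_irrational (\<alpha> / pi)"
  shows "(\<exists>C::real. \<forall>N::nat. N \<ge> 1 \<longrightarrow>
            max_growth (matrix_family \<alpha>) N \<le> C * real N powr (1/3))
       \<and> (\<exists>(A :: nat \<Rightarrow> real^3^3) (x0 :: real^3).
            (\<forall>k. A k \<in> matrix_family \<alpha>) \<and>
            growth_exponent (trajectory A x0) = ereal (1/3))"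
proof
  obtain C where C: "C > 0" "\<And>A N. N \<ge> 1 \<Longrightarrow> \<forall>j\<in>{1..N}. A j \<in> matrix_family \<alpha> \<Longrightarrow>
       onorm ((*v) (matrix_prod A N)) \<le> C * real N powr (1/3)"
    using matrix_prod_cube_root_bound[OF assms] by metis
  show "\<exists>C::real. \<forall>N::nat. N \<ge> 1 \<longrightarrow>
            max_growth (matrix_family \<alpha>) N \<le> C * real N powr (1/3)"
  proof (intro exI[of _ C] allI impI)
    fix N :: nat assume "N \<ge> 1"
    then show "max_growth (matrix_family \<alpha>) N \<le> C * real N powr (1/3)"
      by (intro max_growth_le C(2)) (auto simp: matrix_family_def)
  qed
  obtain c where c: "c > 0" "\<And>n :: nat. n \<ge> 1 \<Longrightarrow> c / real n \<le> \<bar>sin (real n * \<alpha>)\<bar>"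
    using abs_sin_mult_ge[OF assms] by metis
  obtain A x0 where A: "\<And>k. A k \<in> matrix_family \<alpha>"
    and ge: "ereal (1 / 3) \<le> growth_exponent (trajectory A x0)"
    using trajectory_growth_exponent_ge[OF c] by metis
  \<comment> \<open>The uniform bound on products from the first claim caps the exponent of every
    trajectory.\<close>
  have "growth_exponent (trajectory A x0) \<le> ereal (1 / 3)"
  proof (rule growth_exponent_le)
    \<comment> \<open>Adding 1 keeps the constant positive even for \<open>x0 = 0\<close>.\<close>
    show "C * (norm x0 + 1) > 0" using C(1) by (simp add: add_nonneg_pos)
    fix N :: nat assume N: "N \<ge> 1"
    let ?P = "matrix_prod (\<lambda>j. A (j - 1)) N"
    have "norm (trajectory A x0 N) \<le> onorm ((*v) ?P) * norm x0"
      unfolding trajectory_eq_matrix_prod by (intro onorm matrix_vector_mul_bounded_linear)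
    also have "\<dots> \<le> (C * real N powr (1/3)) * (norm x0 + 1)"
      using C(1) A by (intro mult_mono C(2) N) auto
    finally show "norm (trajectory A x0 N) \<le> C * (norm x0 + 1) * real N powr (1/3)"
      by (simp add: mult_ac)
  qed simp
  then show "\<exists>(A :: nat \<Rightarrow> real^3^3) (x0 :: real^3).
            (\<forall>k. A k \<in> matrix_family \<alpha>) \<and>
            growth_exponent (trajectory A x0) = ereal (1/3)"
    using A ge by (meson antisym)
qed

end
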